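(* Let $G$ be a finite group such that $\frac{G}{Z(G)} \cong \mathbb{Z}_p \times \mathbb{Z}_p$, where $p$ is a prime integer. Then \[ E(\Gamma_G) = LE(\Gamma_G) = LE^+(\Gamma_G) = 2(p^2 - 1)|Z(G)| - 2(p + 1). \]
   Context: For a finite non-abelian group $G$ with center $Z(G)$, the commuting graph $\Gamma_G$ is the simple undirected graph with vertex set $G \setminus Z(G)$ in which two distinct vertices $x, y$ are adjacent iff $xy = yx$. For a finite graph $\mathcal{G}$ with vertex set $v(\mathcal{G})$, edge set $e(\mathcal{G})$, adjacency matrix $A$ and (diagonal) degree matrix $D$, put $L = D - A$ and $Q = D + A$. With all sums over eigenvalues counted with multiplicity: the energy is $E(\mathcal{G}) = \sum |\lambda|$ over eigenvalues $\lambda$ of $A$; the Laplacian energy is $LE(\mathcal{G}) = \sum \left|\mu - \frac{2|e(\mathcal{G})|}{|v(\mathcal{G})|}\right|$ over eigenvalues $\mu$ of $L$; the signless Laplacian energy is $LE^+(\mathcal{G}) = \sum \left|\nu - \frac{2|e(\mathcal{G})|}{|v(\mathcal{G})|}\right|$ over eigenvalues $\nu$ of $Q$. *)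

theory Defs
  imports
    "HOL-Algebra.Elementary_Groups"
    "HOL-Computational_Algebra.Primes"
    "Jordan_Normal_Form.Spectral_Radius"
    "Graph_Theory.Pair_Digraph"
begin

subsection \<open>Center and commuting graph\<close>

definition center :: "('a, 'b) monoid_scheme \<Rightarrow> 'a set" where
  "center G = {z \<in> carrier G. \<forall>x \<in> carrier G. z \<otimes>\<^bsub>G\<^esub> x = x \<otimes>\<^bsub>G\<^esub> z}"

text \<open>
  A finite simple undirected graph is represented as a \<^locale>\<open>pair_graph\<close>: a finite loop-free
  digraph with a symmetric arc relation, each undirected edge being a pair of opposite arcs.
\<close>

definition commuting_graph :: "('a, 'b) monoid_scheme \<Rightarrow> 'a pair_pre_digraph" where
  "commuting_graph G =
    \<lparr> pverts = carrier G - center G,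
      parcs = {(x, y). x \<in> carrier G - center G \<and> y \<in> carrier G - center G \<and>
                 x \<noteq> y \<and> x \<otimes>\<^bsub>G\<^esub> y = y \<otimes>\<^bsub>G\<^esub> x} \<rparr>"

lemma pair_graph_commuting_graph:
  assumes "finite (carrier G)"
  shows "pair_graph (commuting_graph G)"
proof
  let ?V = "carrier G - center G"
  have "parcs (commuting_graph G) \<subseteq> ?V \<times> ?V"
    by (auto simp: commuting_graph_def)
  then show "finite (parcs (commuting_graph G))"
    using assms by (meson finite_Diff finite_SigmaI finite_subset)
qed (use assms in \<open>auto simp: commuting_graph_def symmetric_def sym_def\<close>)

subsection \<open>Matrices of a graph\<close>

text \<open>
  The matrices are taken with respect to a duplicate-free list \<open>vs\<close> of the vertices.
\<close>

definition adjacency_mat :: "'a pair_pre_digraph \<Rightarrow> 'a list \<Rightarrow> real mat" where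
  "adjacency_mat \<G> vs = mat (length vs) (length vs)
     (\<lambda>(i, j). if (vs ! i, vs ! j) \<in> parcs \<G> then 1 else 0)"

definition degree_mat :: "'a pair_pre_digraph \<Rightarrow> 'a list \<Rightarrow> real mat" where
  "degree_mat \<G> vs = mat (length vs) (length vs)
     (\<lambda>(i, j). if i = j then real (out_degree (with_proj \<G>) (vs ! i)) else 0)"

definition laplacian_mat :: "'a pair_pre_digraph \<Rightarrow> 'a list \<Rightarrow> real mat" where
  "laplacian_mat \<G> vs = degree_mat \<G> vs - adjacency_mat \<G> vs"

definition signless_laplacian_mat :: "'a pair_pre_digraph \<Rightarrow> 'a list \<Rightarrow> real mat" where
  "signless_laplacian_mat \<G> vs = degree_mat \<G> vs + adjacency_mat \<G> vs"

definition vertex_list :: "'a pair_pre_digraph \<Rightarrow> 'a list" where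
  "vertex_list \<G> = (SOME vs. distinct vs \<and> set vs = pverts \<G>)"

lemma vertex_list:
  assumes "finite (pverts \<G>)"
  shows "distinct (vertex_list \<G>)" "set (vertex_list \<G>) = pverts \<G>"
proof -
  have "\<exists>vs. distinct vs \<and> set vs = pverts \<G>"
    using finite_distinct_list[OF assms] by blast
  from someI_ex[OF this] show "distinct (vertex_list \<G>)" "set (vertex_list \<G>) = pverts \<G>"
    by (simp_all add: vertex_list_def)
qed

subsection \<open>Eigenvalues and energies\<close>

text \<open>
  Real eigenvalues with algebraic multiplicity.  The matrices above are real symmetric for an
  undirected graph, so these are all their eigenvalues.
\<close>

definition eigenvalues :: "real mat \<Rightarrow> real multiset" where
  "eigenvalues A = proots (char_poly A)"

lemma set_mset_eigenvalues:
  assumes "A \<in> carrier_mat n n"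
  shows "set_mset (eigenvalues A) = spectrum A"
proof -
  have "char_poly A \<noteq> 0"
    using degree_monic_char_poly[OF assms] by auto
  then show ?thesis
    using eigenvalue_root_char_poly[OF assms]
    by (auto simp: eigenvalues_def spectrum_def)
qed

definition edges :: "'a pair_pre_digraph \<Rightarrow> 'a set set" where
  "edges \<G> = {{x, y} | x y. (x, y) \<in> parcs \<G>}"

definition avg_degree :: "'a pair_pre_digraph \<Rightarrow> real" where
  "avg_degree \<G> = 2 * real (card (edges \<G>)) / real (card (pverts \<G>))"

definition energy :: "'a pair_pre_digraph \<Rightarrow> real" where
  "energy \<G> = (\<Sum>x\<in>#eigenvalues (adjacency_mat \<G> (vertex_list \<G>)). \<bar>x\<bar>)"

definition laplacian_energy :: "'a pair_pre_digraph \<Rightarrow> real" where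
  "laplacian_energy \<G> =
    (\<Sum>x\<in>#eigenvalues (laplacian_mat \<G> (vertex_list \<G>)). \<bar>x - avg_degree \<G>\<bar>)"

definition signless_laplacian_energy :: "'a pair_pre_digraph \<Rightarrow> real" where
  "signless_laplacian_energy \<G> =
    (\<Sum>x\<in>#eigenvalues (signless_laplacian_mat \<G> (vertex_list \<G>)). \<bar>x - avg_degree \<G>\<bar>)"

text \<open>The choice made in \<^const>\<open>vertex_list\<close> does not affect the eigenvalues.\<close>

lemma char_poly_reindex:
  fixes f :: "'a \<Rightarrow> 'a \<Rightarrow> real"
  assumes "distinct vs" "distinct ws" "set vs = set ws"
  shows "char_poly (mat (length vs) (length vs) (\<lambda>(i, j). f (vs ! i) (vs ! j))) =
         char_poly (mat (length ws) (length ws) (\<lambda>(i, j). f (ws ! i) (ws ! j)))"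
proof -
  define n where "n = length vs"
  let ?A = "\<lambda>us. mat n n (\<lambda>(i, j). f (us ! i) (us ! j))"
  let ?C = "char_poly_matrix (?A vs)"
  have n': "length ws = n"
    using assms distinct_card n_def by metis
  have "mset ws = mset vs"
    using assms set_eq_iff_mset_eq_distinct by metis
  then obtain q where q: "q permutes {..<length vs}" and ws: "permute_list q vs = ws"
    by (rule mset_eq_permutation)
  have q': "q permutes {0..<n}"
    using q by (simp add: n_def atLeast0LessThan)
  have qn: "q i < n" if "i < n" for i
    using q' that by (metis atLeastLessThan_iff permutes_in_image zero_le)
  have nth: "ws ! i = vs ! q i" if "i < n" for i
    using that q by (simp add: ws[symmetric] permute_list_nth n_def)
  have C: "?C \<in> carrier_mat n n" by simp
  let ?B = "mat n n (\<lambda>(i, j). ?C $$ (q i, j))"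
  have eq: "char_poly_matrix (?A ws) = (mat n n (\<lambda>(i, j). ?B\<^sup>T $$ (q i, j)))\<^sup>T"
  proof (rule eq_matI)
    fix i j assume "i < dim_row ((mat n n (\<lambda>(i, j). ?B\<^sup>T $$ (q i, j)))\<^sup>T)"
      "j < dim_col ((mat n n (\<lambda>(i, j). ?B\<^sup>T $$ (q i, j)))\<^sup>T)"
    then have ij: "i < n" "j < n" by simp_all
    have "q i = q j \<longleftrightarrow> i = j"
      using permutes_inj[OF q'] by (simp add: inj_eq)
    then show "char_poly_matrix (?A ws) $$ (i, j) = (mat n n (\<lambda>(i, j). ?B\<^sup>T $$ (q i, j)))\<^sup>T $$ (i, j)"
      using ij qn by (simp add: char_poly_matrix_def nth)
  qed (simp_all add: char_poly_matrix_def)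
  have "det (char_poly_matrix (?A ws)) = signof q * det (?B\<^sup>T)"
    unfolding eq by (subst det_transpose[where n = n]) (simp_all add: det_permute_rows[OF _ q'])
  also have "det (?B\<^sup>T) = signof q * det ?C"
    by (subst det_transpose[where n = n]) (simp_all add: det_permute_rows[OF C q'])
  finally have "det (char_poly_matrix (?A ws)) = det ?C"
    by (simp add: sign_def)
  then show ?thesis
    by (simp add: char_poly_def n' n_def[symmetric])
qed

lemma eigenvalues_vertex_list:
  assumes "distinct vs" "set vs = pverts \<G>"
  shows
    "eigenvalues (adjacency_mat \<G> (vertex_list \<G>)) = eigenvalues (adjacency_mat \<G> vs)"
    "eigenvalues (laplacian_mat \<G> (vertex_list \<G>)) = eigenvalues (laplacian_mat \<G> vs)"
    "eigenvalues (signless_laplacian_mat \<G> (vertex_list \<G>)) =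
       eigenvalues (signless_laplacian_mat \<G> vs)"
proof -
  let ?a = "\<lambda>x y. if (x, y) \<in> parcs \<G> then 1 else (0 :: real)"
  let ?d = "\<lambda>x y. if x = y then real (out_degree (with_proj \<G>) x) else 0"
  have us: "distinct (vertex_list \<G>)" "set (vertex_list \<G>) = set vs"
    using vertex_list[of \<G>] assms(2) finite_set[of vs] by simp_all
  note re = char_poly_reindex[OF us(1) assms(1) us(2)]
  have L: "laplacian_mat \<G> us = mat (length us) (length us)
      (\<lambda>(i, j). ?d (us ! i) (us ! j) - ?a (us ! i) (us ! j))"
    and Q: "signless_laplacian_mat \<G> us = mat (length us) (length us)
      (\<lambda>(i, j). ?d (us ! i) (us ! j) + ?a (us ! i) (us ! j))"
    if "distinct us" for us
    using that
    by (auto simp: laplacian_mat_def signless_laplacian_mat_def degree_mat_def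
        adjacency_mat_def nth_eq_iff_index_eq intro!: eq_matI)
  show "eigenvalues (adjacency_mat \<G> (vertex_list \<G>)) = eigenvalues (adjacency_mat \<G> vs)"
    using re[of ?a] by (simp add: eigenvalues_def adjacency_mat_def)
  show "eigenvalues (laplacian_mat \<G> (vertex_list \<G>)) = eigenvalues (laplacian_mat \<G> vs)"
    using re[of "\<lambda>x y. ?d x y - ?a x y"] us(1) assms(1)
    by (simp add: eigenvalues_def L)
  show "eigenvalues (signless_laplacian_mat \<G> (vertex_list \<G>)) =
      eigenvalues (signless_laplacian_mat \<G> vs)"
    using re[of "\<lambda>x y. ?d x y + ?a x y"] us(1) assms(1)
    by (simp add: eigenvalues_def Q)
qed

end

theory Submission
  imports Defs
begin

text \<open>
  Since the center has index \<open>p\<^sup>2\<close>, every subgroup strictly between the center and \<open>G\<close> has order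
  \<open>p |Z(G)|\<close>.  For noncentral commuting \<open>x\<close> and \<open>y\<close> this applies to \<open>C(x)\<close>, \<open>C(y)\<close> and
  \<open>C(x) \<inter> C(y)\<close>, so the two centralizers coincide.  Hence commuting is an equivalence relation
  on the vertices, and the commuting graph is a disjoint union of \<open>k = p + 1\<close> cliques of size
  \<open>m = (p - 1) |Z(G)|\<close>.

  If \<open>U\<close> is the incidence matrix of vertices and cliques, then \<open>U\<^sup>T U = m I\<close>, and the three
  matrices of the graph are \<open>c I + s U U\<^sup>T\<close> with \<open>(c, s) = (-1, 1)\<close>, \<open>(m, -1)\<close>, \<open>(m - 2, 1)\<close>.
  Sylvester's determinant identity gives the spectrum \<open>c + s m\<close> (\<open>k\<close> times) and \<open>c\<close> (otherwise).
  The average degree is \<open>m - 1\<close>, so each energy is \<open>k (m - 1) + (m k - k) = 2 k (m - 1)\<close>.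
\<close>

section \<open>Sylvester's determinant identity and the spectrum of
  \<open>c I + s U V\<close>\<close>

text \<open>The determinant of the block matrix \<open>?M\<close> is evaluated twice: multiplying by
  \<open>?L\<close> clears the lower left block, multiplying by \<open>?R\<close> the upper right
  one. With a power of \<open>y\<close> on each side no division occurs, so the identity applies
  over a polynomial ring.\<close>

lemma det_scalar_minus_mult_commute:
  fixes U V :: "'a :: idom mat"
  assumes U: "U \<in> carrier_mat n k" and V: "V \<in> carrier_mat k n"
  shows "y ^ k * det (y \<cdot>\<^sub>m 1\<^sub>m n - U * V) = y ^ n * det (y \<cdot>\<^sub>m 1\<^sub>m k - V * U)"
proof -
  let ?M = "four_block_mat (y \<cdot>\<^sub>m 1\<^sub>m n) U V (1\<^sub>m k)"
  let ?L = "four_block_mat (1\<^sub>m n) (0\<^sub>m n k) (- V) (1\<^sub>m k)"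
  let ?R = "four_block_mat (1\<^sub>m n) (- U) (0\<^sub>m k n) (y \<cdot>\<^sub>m 1\<^sub>m k)"
  have M: "?M \<in> carrier_mat (n + k) (n + k)" by simp
  have "?M * ?L = four_block_mat (y \<cdot>\<^sub>m 1\<^sub>m n * 1\<^sub>m n + U * - V) (y \<cdot>\<^sub>m 1\<^sub>m n * 0\<^sub>m n k + U * 1\<^sub>m k)
      (V * 1\<^sub>m n + 1\<^sub>m k * - V) (V * 0\<^sub>m n k + 1\<^sub>m k * 1\<^sub>m k)"
    by (rule mult_four_block_mat) (use U V in auto)
  also have "\<dots> = four_block_mat (y \<cdot>\<^sub>m 1\<^sub>m n - U * V) U (0\<^sub>m k n) (1\<^sub>m k)"
    using U V by (intro cong_four_block_mat) (auto simp: add_uminus_minus_mat[of _ n n])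
  also have "det \<dots> = det (y \<cdot>\<^sub>m 1\<^sub>m n - U * V) * det (1\<^sub>m k)"
    by (rule det_four_block_mat_lower_left_zero) (use U V in auto)
  finally have "det (?M * ?L) = det (y \<cdot>\<^sub>m 1\<^sub>m n - U * V)"
    by simp
  moreover have "det ?L = 1"
    using V by (simp add: det_four_block_mat_upper_right_zero[of _ n _ k])
  ultimately have 1: "det ?M = det (y \<cdot>\<^sub>m 1\<^sub>m n - U * V)"
    using V by (simp add: det_mult[OF M])
  have "?M * ?R = four_block_mat (y \<cdot>\<^sub>m 1\<^sub>m n * 1\<^sub>m n + U * 0\<^sub>m k n) (y \<cdot>\<^sub>m 1\<^sub>m n * - U + U * (y \<cdot>\<^sub>m 1\<^sub>m k))
      (V * 1\<^sub>m n + 1\<^sub>m k * 0\<^sub>m k n) (V * - U + 1\<^sub>m k * (y \<cdot>\<^sub>m 1\<^sub>m k))"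
    by (rule mult_four_block_mat) (use U V in auto)
  also have "\<dots> = four_block_mat (y \<cdot>\<^sub>m 1\<^sub>m n) (0\<^sub>m n k) V (y \<cdot>\<^sub>m 1\<^sub>m k - V * U)"
    using U V
    by (intro cong_four_block_mat)
      (auto simp: mult_smult_distrib[of _ n k] mult_smult_assoc_mat[of _ n n])
  also have "det \<dots> = det (y \<cdot>\<^sub>m 1\<^sub>m n) * det (y \<cdot>\<^sub>m 1\<^sub>m k - V * U)"
    by (rule det_four_block_mat_upper_right_zero) (use U V in auto)
  finally have "det (?M * ?R) = y ^ n * det (y \<cdot>\<^sub>m 1\<^sub>m k - V * U)"
    by simp
  moreover have "det ?R = y ^ k"
    using U by (simp add: det_four_block_mat_lower_left_zero[of _ n _ k])
  ultimately have "det ?M * y ^ k = y ^ n * det (y \<cdot>\<^sub>m 1\<^sub>m k - V * U)"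
    using U by (simp add: det_mult[OF M])
  then show ?thesis by (simp add: 1 mult.commute)
qed

text \<open>The characteristic matrices are \<open>(X - c) I - (s U) V\<close> and
  \<open>(X - c) I - V (s U)\<close>, so this is Sylvester's identity over polynomials with
  \<open>y = X - c\<close>.\<close>

lemma char_poly_scalar_plus_mult_commute:
  fixes U V :: "'a :: field mat"
  assumes U: "U \<in> carrier_mat n k" and V: "V \<in> carrier_mat k n"
  shows "[:- c, 1:] ^ k * char_poly (c \<cdot>\<^sub>m 1\<^sub>m n + s \<cdot>\<^sub>m (U * V)) =
    [:- c, 1:] ^ n * char_poly (c \<cdot>\<^sub>m 1\<^sub>m k + s \<cdot>\<^sub>m (V * U))"
proof -
  have sum_const: "(\<Sum>i\<in>I. [:f i:]) = [:\<Sum>i\<in>I. f i:]" for f :: "nat \<Rightarrow> 'a" and I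
    by (induction I rule: infinite_finite_induct) auto
  let ?U = "map_mat (\<lambda>a. [:s * a:]) U" and ?V = "map_mat (\<lambda>a. [:a:]) V"
  have "char_poly_matrix (c \<cdot>\<^sub>m 1\<^sub>m n + s \<cdot>\<^sub>m (U * V)) = [:- c, 1:] \<cdot>\<^sub>m 1\<^sub>m n - ?U * ?V"
    using U V by (intro eq_matI)
      (auto simp: char_poly_matrix_def scalar_prod_def sum_const sum_distrib_left ac_simps)
  moreover have "char_poly_matrix (c \<cdot>\<^sub>m 1\<^sub>m k + s \<cdot>\<^sub>m (V * U)) = [:- c, 1:] \<cdot>\<^sub>m 1\<^sub>m k - ?V * ?U"
    using U V by (intro eq_matI)
      (auto simp: char_poly_matrix_def scalar_prod_def sum_const sum_distrib_left ac_simps)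
  ultimately show ?thesis
    using det_scalar_minus_mult_commute[of ?U n k ?V "[:- c, 1:]"] U V
    by (simp add: char_poly_def)
qed

lemma proots_char_poly_scalar:
  "proots (char_poly (c \<cdot>\<^sub>m 1\<^sub>m k)) = replicate_mset k (c :: 'a :: field)"
proof -
  have "char_poly_matrix (c \<cdot>\<^sub>m 1\<^sub>m k) = [:- c, 1:] \<cdot>\<^sub>m 1\<^sub>m k"
    by (intro eq_matI) (auto simp: char_poly_matrix_def)
  then show ?thesis by (simp add: char_poly_def proots_power)
qed

text \<open>Since \<open>V * U\<close> is scalar, the small matrix is \<open>(c + s * m) I\<close>
  and its roots are known. The additive form avoids truncated subtraction of multisets.\<close>

lemma eigenvalues_scalar_plus_mult:
  assumes U: "U \<in> carrier_mat n k" and V: "V \<in> carrier_mat k n" and VU: "V * U = m \<cdot>\<^sub>m 1\<^sub>m k"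
  shows "eigenvalues (c \<cdot>\<^sub>m 1\<^sub>m n + s \<cdot>\<^sub>m (U * V)) + replicate_mset k c =
    replicate_mset n c + replicate_mset k (c + s * m)"
proof -
  let ?A = "c \<cdot>\<^sub>m 1\<^sub>m n + s \<cdot>\<^sub>m (U * V)"
  have A: "?A \<in> carrier_mat n n" using U V by auto
  have "c \<cdot>\<^sub>m 1\<^sub>m k + s \<cdot>\<^sub>m (V * U) = (c + s * m) \<cdot>\<^sub>m 1\<^sub>m k"
    by (intro eq_matI) (auto simp: VU)
  then have "[:- c, 1:] ^ k * char_poly ?A = [:- c, 1:] ^ n * char_poly ((c + s * m) \<cdot>\<^sub>m 1\<^sub>m k)"
    using char_poly_scalar_plus_mult_commute[OF U V, of c s] by simp
  then have "proots ([:- c, 1:] ^ k * char_poly ?A) =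
      proots ([:- c, 1:] ^ n * char_poly ((c + s * m) \<cdot>\<^sub>m 1\<^sub>m k))"
    by simp
  \<comment> \<open>\<open>proots\<close> turns a product into a sum of multisets only for nonzero
    factors.\<close>
  moreover have "char_poly ?A \<noteq> 0" "char_poly ((c + s * m) \<cdot>\<^sub>m 1\<^sub>m k) \<noteq> 0"
    using degree_monic_char_poly[OF A] degree_monic_char_poly[of "(c + s * m) \<cdot>\<^sub>m 1\<^sub>m k" k] by auto
  ultimately show ?thesis
    by (simp add: proots_mult proots_power proots_char_poly_scalar eigenvalues_def add.commute)
qed

section \<open>Disjoint unions of cliques of equal size: counting, incidence matrices,
  energies\<close>

text \<open>Each fibre of the map from arcs to edges is \<open>{(x, y), (y, x)}\<close> by symmetry,
  and these two arcs differ by irreflexivity.\<close>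

lemma two_card_edges:
  assumes "finite (parcs \<G>)" "sym (parcs \<G>)" "irrefl (parcs \<G>)"
  shows "2 * card (edges \<G>) = card (parcs \<G>)"
proof -
  let ?e = "\<lambda>(x, y). {x, y}"
  have edges: "edges \<G> = ?e ` parcs \<G>"
    by (auto simp: edges_def)
  have "card {a \<in> parcs \<G>. ?e a = E} = 2" if E_edge: "E \<in> edges \<G>" for E
  proof -
    obtain x y where xy: "(x, y) \<in> parcs \<G>" and E: "E = {x, y}"
      using E_edge unfolding edges_def by blast
    then have "{a \<in> parcs \<G>. ?e a = E} = {(x, y), (y, x)}"
      using assms(2) by (auto simp: doubleton_eq_iff dest: symD)
    moreover have "x \<noteq> y"
      using xy assms(3) by (auto simp: irrefl_def)
    ultimately show ?thesis by simp
  qed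
  moreover have "card (parcs \<G>) = (\<Sum>E\<in>edges \<G>. card {a \<in> parcs \<G>. ?e a = E})"
    unfolding card_eq_sum edges by (rule sum.image_gen[OF assms(1)])
  ultimately show ?thesis by simp
qed

lemma card_quotient_uniform:
  assumes "finite A" "equiv A R" "\<And>C. C \<in> A // R \<Longrightarrow> card C = m"
  shows "m * card (A // R) = card A"
proof -
  have "m * card (A // R) = card (\<Union> (A // R))"
    using assms quotient_disj[OF assms(2)] finite_quotient[OF assms(1) equiv_type[OF assms(2)]]
    by (intro card_partition) (auto simp: Union_quotient)
  then show ?thesis
    using assms(2) by (simp add: Union_quotient)
qed

text \<open>An entry of \<open>U\<^sup>T * U\<close> counts the elements common to two classes:
  \<open>m\<close> on the diagonal and 0 elsewhere, by disjointness. An entry of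
  \<open>U * U\<^sup>T\<close> counts the classes containing both elements: one if they are related,
  otherwise none.\<close>

lemma incidence_mat_products:
  fixes U :: "real mat"
  assumes R: "equiv (set vs) R" and "distinct vs" "distinct Cs" "set Cs = set vs // R"
    and card: "\<And>C. C \<in> set Cs \<Longrightarrow> card C = m"
    and U: "U = mat (length vs) (length Cs) (\<lambda>(i, j). of_bool (vs ! i \<in> Cs ! j))"
  shows "U\<^sup>T * U = real m \<cdot>\<^sub>m 1\<^sub>m (length Cs)"
    and "U * U\<^sup>T = mat (length vs) (length vs) (\<lambda>(i, j). of_bool ((vs ! i, vs ! j) \<in> R))"
proof -
  have sum_nth: "(\<Sum>i = 0..<length xs. f (xs ! i)) = (\<Sum>x\<in>set xs. f x)"
    if "distinct xs" for xs :: "'b list" and f :: "'b \<Rightarrow> real"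
    using that by (simp add: sum_list_distinct_conv_sum_set[symmetric] sum_list_sum_nth)
  show "U\<^sup>T * U = real m \<cdot>\<^sub>m 1\<^sub>m (length Cs)"
  proof (rule eq_matI)
    fix i j assume "i < dim_row (real m \<cdot>\<^sub>m 1\<^sub>m (length Cs))" "j < dim_col (real m \<cdot>\<^sub>m 1\<^sub>m (length Cs))"
    then have ij: "i < length Cs" "j < length Cs" by simp_all
    then have C: "Cs ! i \<in> set vs // R" "Cs ! j \<in> set vs // R"
      using nth_mem assms(4) by blast+
    have "(U\<^sup>T * U) $$ (i, j) =
        (\<Sum>l = 0..<length vs. of_bool (vs ! l \<in> Cs ! i) * of_bool (vs ! l \<in> Cs ! j))"
      using ij by (simp add: U scalar_prod_def)
    also have "\<dots> = real (card (set vs \<inter> {x. x \<in> Cs ! i \<and> x \<in> Cs ! j}))"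
      by (subst sum_nth[OF assms(2), of "\<lambda>x. of_bool (x \<in> Cs ! i) * of_bool (x \<in> Cs ! j)"])
        (simp flip: of_bool_conj)
    also have "set vs \<inter> {x. x \<in> Cs ! i \<and> x \<in> Cs ! j} = (if i = j then Cs ! i else {})"
      using quotient_disj[OF R C] in_quotient_imp_subset[OF R C(1)] ij assms(3)
      by (auto simp: nth_eq_iff_index_eq)
    finally show "(U\<^sup>T * U) $$ (i, j) = (real m \<cdot>\<^sub>m 1\<^sub>m (length Cs)) $$ (i, j)"
      using ij card by simp
  qed (simp_all add: U)
  show "U * U\<^sup>T = mat (length vs) (length vs) (\<lambda>(i, j). of_bool ((vs ! i, vs ! j) \<in> R))"
  proof (rule eq_matI)
    fix i j
    assume "i < dim_row (mat (length vs) (length vs) (\<lambda>(i, j). of_bool ((vs ! i, vs ! j) \<in> R)))"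
      "j < dim_col (mat (length vs) (length vs) (\<lambda>(i, j). of_bool ((vs ! i, vs ! j) \<in> R)))"
    then have ij: "i < length vs" "j < length vs" by simp_all
    let ?x = "vs ! i" and ?y = "vs ! j"
    have "(U * U\<^sup>T) $$ (i, j) =
        (\<Sum>l = 0..<length Cs. of_bool (?x \<in> Cs ! l) * of_bool (?y \<in> Cs ! l))"
      using ij by (simp add: U scalar_prod_def)
    also have "\<dots> = real (card (set vs // R \<inter> {C. ?x \<in> C \<and> ?y \<in> C}))"
      by (subst sum_nth[OF assms(3), of "\<lambda>C. of_bool (?x \<in> C) * of_bool (?y \<in> C)"])
        (simp add: assms(4) finite_quotient[OF _ equiv_type[OF R]] flip: of_bool_conj)
    also have "set vs // R \<inter> {C. ?x \<in> C \<and> ?y \<in> C} = (if (?x, ?y) \<in> R then {R `` {?x}} else {})"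
    proof (cases "(?x, ?y) \<in> R")
      case True
      then have "R `` {?x} \<in> set vs // R" "{?x, ?y} \<subseteq> R `` {?x}"
        using ij equiv_class_self[OF R] by (simp_all add: quotientI)
      moreover have "C = R `` {?x}" if C: "C \<in> set vs // R" "?x \<in> C" for C
      proof -
        obtain z where "C = R `` {z}"
          using C(1) by (rule quotientE)
        then show ?thesis
          using C(2) equiv_class_eq[OF R] by blast
      qed
      ultimately have "set vs // R \<inter> {C. ?x \<in> C \<and> ?y \<in> C} = {R `` {?x}}"
        by blast
      with True show ?thesis by simp
    next
      case False
      then have "?x \<notin> C \<or> ?y \<notin> C" if "C \<in> set vs // R" for C
        using quotient_eq_iff[OF R that that] by blast
      with False show ?thesis by auto
    qed
    finally show "(U * U\<^sup>T) $$ (i, j) =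
        mat (length vs) (length vs) (\<lambda>(i, j). of_bool ((vs ! i, vs ! j) \<in> R)) $$ (i, j)"
      using ij by simp
  qed (simp_all add: U)
qed

lemma cluster_graph_energies:
  fixes \<G> :: "'a pair_pre_digraph"
  assumes fin: "finite (pverts \<G>)" and ne: "pverts \<G> \<noteq> {}"
    and R: "equiv (pverts \<G>) R" and arcs: "parcs \<G> = R - Id"
    and card: "\<And>C. C \<in> pverts \<G> // R \<Longrightarrow> card C = m"
  defines "e \<equiv> 2 * real (card (pverts \<G> // R)) * (real m - 1)"
  shows "energy \<G> = e" "laplacian_energy \<G> = e" "signless_laplacian_energy \<G> = e"
proof -
  obtain vs where vs: "distinct vs" "set vs = pverts \<G>"
    using finite_distinct_list[OF fin] by blast
  have R_sub: "R \<subseteq> pverts \<G> \<times> pverts \<G>"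
    using equiv_type[OF R] .
  then have finR: "finite R"
    using fin finite_subset by blast
  have finQ: "finite (pverts \<G> // R)"
    using fin R_sub by (rule finite_quotient)
  then obtain Cs where Cs: "distinct Cs" "set Cs = set vs // R"
    using finite_distinct_list vs(2) by metis
  define n k where "n = length vs" and "k = length Cs"
  have n: "n = card (pverts \<G>)" and k: "k = card (pverts \<G> // R)"
    using vs Cs distinct_card n_def k_def by metis+
  have cls: "card (R `` {x}) = m" "x \<in> R `` {x}" "finite (R `` {x})" if "x \<in> pverts \<G>" for x
    using that card finR equiv_class_self[OF R] by (auto simp: quotientI)
  have mk: "n = m * k"
    using card_quotient_uniform[OF fin R card] by (simp add: n k)
  \<comment> \<open>Positivity makes the natural number \<open>m - 1\<close> agree with the real
    one, and later removes the absolute value of \<open>real m - 1\<close>.\<close>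
  have m: "m > 0"
    using ne fin mk n by (cases m) auto
  have outdeg: "real (out_degree (with_proj \<G>) x) = real m - 1" if "x \<in> pverts \<G>" for x
  proof -
    have "out_arcs (with_proj \<G>) x = Pair x ` (R `` {x} - {x})"
      by (auto simp: out_arcs_def arcs)
    then show ?thesis
      using cls[OF that] m by (simp add: out_degree_def card_image inj_on_def of_nat_diff)
  qed
  have avg: "avg_degree \<G> = real m - 1"
  proof -
    have "parcs \<G> = (SIGMA x:pverts \<G>. R `` {x} - {x})"
      using R_sub by (auto simp: arcs)
    then have "card (parcs \<G>) = (\<Sum>x\<in>pverts \<G>. card (R `` {x} - {x}))"
      using fin cls by (simp add: card_SigmaI)
    then have "card (parcs \<G>) = n * (m - 1)"
      using cls by (simp add: n)
    moreover have "sym R" using R by (rule equivE)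
    ultimately have "2 * card (edges \<G>) = n * (m - 1)"
      using two_card_edges[of \<G>] finR by (auto simp: arcs irrefl_def sym_def)
    then have "2 * real (card (edges \<G>)) = real n * real (m - 1)"
      by (metis of_nat_mult of_nat_numeral)
    then show ?thesis
      using ne fin m by (simp add: avg_degree_def n of_nat_diff)
  qed
  define U :: "real mat" where "U = mat n k (\<lambda>(i, j). of_bool (vs ! i \<in> Cs ! j))"
  have U: "U \<in> carrier_mat n k" by (simp add: U_def)
  have UU: "U\<^sup>T * U = real m \<cdot>\<^sub>m 1\<^sub>m k"
    "U * U\<^sup>T = mat n n (\<lambda>(i, j). of_bool ((vs ! i, vs ! j) \<in> R))"
    using incidence_mat_products[of vs R Cs m U] R vs Cs card
    by (simp_all add: U_def n_def k_def)
  \<comment> \<open>Summing \<open>f\<close> over the additive multiset identity and moving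
    \<open>k * f c\<close> to the other side gives \<open>c\<close> the real weight
    \<open>n - k\<close>.\<close>
  have sum: "(\<Sum>x\<in>#eigenvalues (c \<cdot>\<^sub>m 1\<^sub>m n + s \<cdot>\<^sub>m (U * U\<^sup>T)). f x) =
      (real n - real k) * f c + real k * f (c + s * real m)" for c s and f :: "real \<Rightarrow> real"
    using arg_cong[OF eigenvalues_scalar_plus_mult[OF U _ UU(1), of c s], of "\<lambda>M. \<Sum>x\<in>#M. f x"] U
    by (simp add: algebra_simps)
  have refl: "(vs ! i, vs ! i) \<in> R" if "i < n" for i
    using that R vs by (metis equivE refl_onD nth_mem n_def)
  \<comment> \<open>\<open>R\<close> contains the diagonal and the arcs do not, so
    \<open>U * U\<^sup>T\<close> is the adjacency matrix plus the identity.\<close>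
  have A: "adjacency_mat \<G> vs = (- 1) \<cdot>\<^sub>m 1\<^sub>m n + 1 \<cdot>\<^sub>m (U * U\<^sup>T)"
    using refl vs unfolding UU
    by (intro eq_matI) (auto simp: adjacency_mat_def n_def arcs nth_eq_iff_index_eq)
  have D: "degree_mat \<G> vs = (real m - 1) \<cdot>\<^sub>m 1\<^sub>m n"
    using vs nth_mem[of _ vs] by (intro eq_matI) (auto simp: degree_mat_def n_def outdeg)
  have L: "laplacian_mat \<G> vs = real m \<cdot>\<^sub>m 1\<^sub>m n + (- 1) \<cdot>\<^sub>m (U * U\<^sup>T)"
    unfolding laplacian_mat_def A D UU by (intro eq_matI) auto
  have Q: "signless_laplacian_mat \<G> vs = (real m - 2) \<cdot>\<^sub>m 1\<^sub>m n + 1 \<cdot>\<^sub>m (U * U\<^sup>T)"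
    unfolding signless_laplacian_mat_def A D UU by (intro eq_matI) auto
  note ev = eigenvalues_vertex_list[OF vs]
  have m1: "\<bar>real m - 1\<bar> = real m - 1" using m by simp
  \<comment> \<open>In all three cases the absolute values to be summed are 1, with weight
    \<open>n - k\<close>, and \<open>m - 1\<close>, with weight \<open>k\<close>: the eigenvalues
    are \<open>-1\<close> and \<open>m - 1\<close> for the adjacency matrix, \<open>m\<close> and 0
    for the Laplacian, \<open>m - 2\<close> and \<open>2 m - 2\<close> for the signless one, the
    last two shifted by \<open>m - 1\<close>.\<close>
  show "energy \<G> = e"
    unfolding energy_def ev A sum e_def using m1 by (simp add: mk k algebra_simps)
  show "laplacian_energy \<G> = e"
    unfolding laplacian_energy_def ev L sum e_def avg using m1 by (simp add: mk k algebra_simps)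
  show "signless_laplacian_energy \<G> = e"
    unfolding signless_laplacian_energy_def ev Q sum e_def avg using m1 by (simp add: mk k algebra_simps)
qed

section \<open>Centralizers in a group whose center has index p squared\<close>

context group
begin

lemma inv_commute:
  assumes "x \<in> carrier G" "y \<in> carrier G" "x \<otimes> y = y \<otimes> x"
  shows "inv x \<otimes> y = y \<otimes> inv x"
proof -
  have "y = x \<otimes> (y \<otimes> inv x)"
    using assms(1,2) by (simp add: m_assoc[symmetric] assms(3)) (simp add: m_assoc)
  then show ?thesis
    using inv_solve_left'[of "y \<otimes> inv x" x y] assms(1,2) by simp
qed

lemma mult_commute:
  assumes "x \<in> carrier G" "y \<in> carrier G" "z \<in> carrier G" "x \<otimes> z = z \<otimes> x" "y \<otimes> z = z \<otimes> y"
  shows "x \<otimes> y \<otimes> z = z \<otimes> (x \<otimes> y)"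
proof -
  have "x \<otimes> y \<otimes> z = x \<otimes> z \<otimes> y"
    using assms(1-3,5) by (simp add: m_assoc)
  then show ?thesis
    using assms(1-4) by (simp add: m_assoc)
qed

lemma subgroup_center: "subgroup (center G) G"
proof
  show "center G \<subseteq> carrier G" by (auto simp: center_def)
  show "\<one> \<in> center G" by (auto simp: center_def)
next
  fix x y assume "x \<in> center G" "y \<in> center G"
  then show "x \<otimes> y \<in> center G"
    unfolding center_def by (blast intro: mult_commute m_closed)
next
  fix x assume x: "x \<in> center G"
  show "inv x \<in> center G"
    using x unfolding center_def by (blast intro: inv_commute inv_closed)
qed

lemma subgroup_centralizer:
  assumes "x \<in> carrier G"
  shows "subgroup {y \<in> carrier G. x \<otimes> y = y \<otimes> x} G"
proof
  fix y z assume "y \<in> {y \<in> carrier G. x \<otimes> y = y \<otimes> x}" "z \<in> {y \<in> carrier G. x \<otimes> y = y \<otimes> x}"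
  then show "y \<otimes> z \<in> {y \<in> carrier G. x \<otimes> y = y \<otimes> x}"
    using assms mult_commute[of y z x] by simp
next
  fix y assume "y \<in> {y \<in> carrier G. x \<otimes> y = y \<otimes> x}"
  then show "inv y \<in> {y \<in> carrier G. x \<otimes> y = y \<otimes> x}"
    using assms inv_commute[of y x] by simp
qed (use assms in auto)

text \<open>By Lagrange the indices \<open>a\<close> of \<open>K\<close> in \<open>H\<close> and
  \<open>b\<close> of \<open>H\<close> in \<open>G\<close> multiply to \<open>p\<^sup>2\<close>.
  Both inclusions are strict, which leaves only \<open>a = p\<close> among the divisors 1,
  \<open>p\<close> and \<open>p\<^sup>2\<close>.\<close>

lemma card_subgroup_between:
  assumes fin: "finite (carrier G)" and p: "prime p" and ord: "Coset.order G = p\<^sup>2 * card K"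
    and K: "subgroup K G" and H: "subgroup H G" and "K \<subset> H" "H \<noteq> carrier G"
  shows "card H = p * card K"
proof -
  interpret H: group "G\<lparr>carrier := H\<rparr>"
    using H by (rule subgroup_imp_group)
  have finH: "finite H"
    using fin H finite_subset subgroup.subset by blast
  have K0: "card K > 0"
    using subgroup.finite_imp_card_positive[OF K fin] .
  define a where "a = card (rcosets\<^bsub>G\<lparr>carrier := H\<rparr>\<^esub> K)"
  define b where "b = card (rcosets H)"
  have a: "card H = a * card K"
    using H.lagrange[OF subgroup_incl[OF K H]] \<open>K \<subset> H\<close> by (simp add: Coset.order_def a_def)
  have b: "Coset.order G = b * card H"
    using lagrange[OF H] by (simp add: b_def)
  have "b * a = p\<^sup>2"
    using ord K0 unfolding b a by simp
  then have "a dvd p\<^sup>2" by (metis dvd_triv_right)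
  then obtain i where i: "i \<le> 2" "a = p ^ i"
    using divides_primepow_nat[OF p] by blast
  have "card K < card H"
    using psubset_card_mono[OF finH \<open>K \<subset> H\<close>] .
  then have "i \<noteq> 0" using a i(2) by (cases "i = 0") auto
  have "card H < Coset.order G"
    using psubset_card_mono[OF fin, of H] subgroup.subset[OF H] \<open>H \<noteq> carrier G\<close> by (auto simp: Coset.order_def)
  then have "i \<noteq> 2" using a i(2) ord by (cases "i = 2") auto
  then have "i = 1" using i \<open>i \<noteq> 0\<close> by linarith
  then show ?thesis using a i by simp
qed

lemma commuting_classes:
  assumes fin: "finite (carrier G)" and p: "prime p"
    and ord: "Coset.order G = p\<^sup>2 * card (center G)"
  defines "V \<equiv> carrier G - center G"
  defines "R \<equiv> {(x, y). x \<in> V \<and> y \<in> V \<and> x \<otimes> y = y \<otimes> x}"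
  shows "equiv V R" "\<And>C. C \<in> V // R \<Longrightarrow> card C = (p - 1) * card (center G)"
proof -
  define C where "C x = {y \<in> carrier G. x \<otimes> y = y \<otimes> x}" for x
  note between = card_subgroup_between[OF fin p ord subgroup_center]
  have sub: "subgroup (C x) G" and ZC: "center G \<subseteq> C x" and xC: "x \<in> C x" if "x \<in> carrier G" for x
    using subgroup_centralizer[OF that] that by (auto simp: C_def center_def)
  have proper: "C x \<noteq> carrier G" if "x \<in> V" for x
    using that by (auto simp: C_def V_def center_def)
  have cardC: "card (C x) = p * card (center G)" if "x \<in> V" for x
  proof -
    have "x \<in> carrier G" "center G \<subset> C x"
      using ZC xC that by (auto simp: V_def)
    then show ?thesis
      using between[OF sub _ proper[OF that]] by blast
  qed
  \<comment> \<open>The intersection of the two centralizers still contains the noncentral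
    \<open>x\<close>, so it lies strictly above the center and has the same order as
    \<open>C x\<close>, hence equals it.\<close>
  have C_sub: "C x \<subseteq> C y" if "x \<in> V" "y \<in> V" "x \<in> C y" for x y
  proof -
    have "x \<in> carrier G" "y \<in> carrier G" "x \<notin> center G"
      using that by (simp_all add: V_def)
    then have "center G \<subset> C x \<inter> C y"
      using ZC xC that(3) by blast
    moreover have "C x \<inter> C y \<noteq> carrier G"
      using proper[OF that(1)] unfolding C_def by blast
    moreover have "subgroup (C x \<inter> C y) G"
      using that sub by (intro subgroups_Inter_pair) (auto simp: V_def)
    ultimately have "card (C x \<inter> C y) = card (C x)"
      using between cardC that by simp
    moreover have "finite (C x)"
      using fin by (simp add: C_def)
    ultimately have "C x \<inter> C y = C x"
      by (intro card_subset_eq) auto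
    then show ?thesis by blast
  qed
  show equiv: "equiv V R"
  proof (rule equivI)
    show "R \<subseteq> V \<times> V" "refl_on V R" "sym R"
      unfolding R_def refl_on_def sym_def by fastforce+
    show "trans R"
    proof (rule transI)
      \<comment> \<open>Transitivity is the inclusion of \<open>C y\<close> in \<open>C z\<close>,
        applied to \<open>x\<close>.\<close>
      fix x y z assume "(x, y) \<in> R" "(y, z) \<in> R"
      then have "x \<in> V" "y \<in> V" "z \<in> V" "y \<in> C z" "x \<in> C y"
        unfolding R_def V_def C_def by simp_all
      then show "(x, z) \<in> R"
        using C_sub[of y z] unfolding R_def C_def by fastforce
    qed
  qed
  fix D assume "D \<in> V // R"
  \<comment> \<open>The class of \<open>x\<close> is its centralizer without the center, whence the
    size \<open>p * card (center G) - card (center G)\<close>.\<close>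
  then obtain x where x: "x \<in> V" and D: "D = C x - center G"
    by (auto simp: quotient_def R_def C_def V_def)
  have "card D = card (C x) - card (center G)"
    unfolding D using x ZC fin by (intro card_Diff_subset) (auto simp: V_def center_def)
  then show "card D = (p - 1) * card (center G)"
    using cardC[OF x] by (simp add: diff_mult_distrib)
qed

end

section \<open>Clique number and clique size of the commuting graph, and the resulting
  energies\<close>

theorem theorem2p2:
  fixes G :: "('a, 'b) monoid_scheme" and p :: nat
  assumes "group G"
    and "finite (carrier G)"
    and "prime p"
    and "G Mod center G \<cong> integer_mod_group p \<times>\<times> integer_mod_group p"
  shows "energy (commuting_graph G) = laplacian_energy (commuting_graph G)
    \<and> laplacian_energy (commuting_graph G) = signless_laplacian_energy (commuting_graph G)
    \<and> signless_laplacian_energy (commuting_graph G) =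
        2 * ((real p)^2 - 1) * real (card (center G)) - 2 * (real p + 1)"
proof -
  interpret group G by fact
  let ?\<Gamma> = "commuting_graph G" and ?z = "card (center G)"
  define V where "V = carrier G - center G"
  define R where "R = {(x, y). x \<in> V \<and> y \<in> V \<and> x \<otimes>\<^bsub>G\<^esub> y = y \<otimes>\<^bsub>G\<^esub> x}"
  have p2: "p \<ge> 2" using assms(3) by (rule prime_ge_2_nat)
  have z: "?z > 0"
    using subgroup.finite_imp_card_positive[OF subgroup_center assms(2)] .
  have "card (carrier (G Mod center G)) = card (carrier (integer_mod_group p \<times>\<times> integer_mod_group p))"
    using assms(4) by (auto simp: is_iso_def iso_def intro: bij_betw_same_card)
  also have "\<dots> = p\<^sup>2"
    \<comment> \<open>The bound on \<open>p\<close> excludes \<open>p = 0\<close>, for which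
      \<open>integer_mod_group\<close> has all integers as its carrier.\<close>
    using p2 by (simp add: carrier_integer_mod_group card_cartesian_product power2_eq_square)
  finally have ord: "Coset.order G = p\<^sup>2 * ?z"
    using lagrange[OF subgroup_center] by (simp add: FactGroup_def)
  note classes = commuting_classes[OF assms(2,3) ord, folded V_def, folded R_def]
  have verts: "pverts ?\<Gamma> = V" and arcs: "parcs ?\<Gamma> = R - Id"
    by (auto simp: commuting_graph_def V_def R_def)
  have finV: "finite V" using assms(2) by (simp add: V_def)
  have "card V = Coset.order G - ?z"
    unfolding V_def Coset.order_def using subgroup.subset[OF subgroup_center] assms(2)
    by (intro card_Diff_subset) (auto intro: finite_subset)
  then have cardV: "card V = (p\<^sup>2 - 1) * ?z"
    by (simp add: ord diff_mult_distrib)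
  then have V: "V \<noteq> {}"
    using z p2 mult_le_mono[OF p2 p2] by (auto simp: power2_eq_square)
  have "(p - 1) * ?z * card (V // R) = card V"
    using card_quotient_uniform[OF finV classes] .
  \<comment> \<open>This factors \<open>p\<^sup>2 - 1\<close>; the case split on \<open>p\<close>
    resolves the natural subtraction. Cancelling the class size then leaves \<open>p + 1\<close>
    classes.\<close>
  also have "\<dots> = (p - 1) * ?z * (p + 1)"
    unfolding cardV by (cases p) (simp_all add: power2_eq_square algebra_simps)
  finally have "(p - 1) * ?z * card (V // R) = (p - 1) * ?z * (p + 1)" .
  moreover have "(p - 1) * ?z \<noteq> 0"
    using p2 z by simp
  ultimately have "card (V // R) = p + 1"
    by (simp only: mult_cancel_left) simp
  then have "2 * real (card (V // R)) * (real ((p - 1) * ?z) - 1) =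
      2 * (real p + 1) * ((real p - 1) * real ?z - 1)"
    using p2 by (simp add: of_nat_diff)
  also have "\<dots> = 2 * ((real p)^2 - 1) * real ?z - 2 * (real p + 1)"
    by (simp add: power2_eq_square algebra_simps)
  finally have e: "2 * real (card (V // R)) * (real ((p - 1) * ?z) - 1) =
      2 * ((real p)^2 - 1) * real ?z - 2 * (real p + 1)" .
  show ?thesis
    using cluster_graph_energies[of ?\<Gamma> R "(p - 1) * ?z", unfolded verts e,
        OF finV V classes(1) arcs classes(2)]
    by metis
qed

end
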